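(* Let $n\ge 3$, let $\mathbb{M}^n$ be a Cartan-Hadamard model manifold associated to a function $\psi$, and let $p,q>0$ satisfy $\frac{1}{p+1}+\frac{1}{q+1}\le\frac{n-2}{n}$. Then, given any $(\xi,\eta)\in(0,+\infty)^2$, the Cauchy problem $CP(\xi,\eta)$ coupled with the condition $$u(R)=v(R)=0\qquad\text{for some }R>0$$ has no positive solution on $(0,R)$ (i.e. no solution with $u>0$ and $v>0$ on $(0,R)$).
   Context: A (noncompact) model manifold $\mathbb{M}^n$ associated to $\psi$ is a Riemannian manifold whose metric, in global polar coordinates $(r,\vartheta)\in\mathbb{R}^+\times\mathbb{S}^{n-1}$ about a pole $o$, is $g=dr\otimes dr+\psi^2(r)\,g_{\mathbb{S}^{n-1}}$, where $\psi\in C^1([0,+\infty))\cap C^\infty((0,+\infty))$, $\psi>0$ on $(0,+\infty)$, $\psi(0)=0$, $\psi'(0)=1$. It is Cartan-Hadamard if and only if $\psi$ is in addition convex. For $(\xi,\eta)\in(0,+\infty)^2$, $CP(\xi,\eta)$ denotes the Cauchy problem for functions $u,v$ of $r$ (of class $C^1$ up to $r=0$ and $C^2$ for $r>0$) $$(\psi^{n-1}u')'+\psi^{n-1}|v|^{q-1}v=0,\quad (\psi^{n-1}v')'+\psi^{n-1}|u|^{p-1}u=0\ \ (r>0),\quad u'(0)=v'(0)=0,\ u(0)=\xi,\ v(0)=\eta.$$ *)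

theory Defs
  imports "HOL-Analysis.Analysis"
begin

text \<open>
  Functions of class \<open>C\<^sup>k\<close> on a set. The derivatives are relative to the set, hence one-sided at an
  end point that belongs to the interval; nothing is asked of the values of the function off the set.
\<close>

primrec Ck_on :: "nat \<Rightarrow> real set \<Rightarrow> (real \<Rightarrow> real) \<Rightarrow> bool" where
  "Ck_on 0 S f \<longleftrightarrow> continuous_on S f"
| "Ck_on (Suc k) S f \<longleftrightarrow>
     (\<exists>f'. (\<forall>x\<in>S. (f has_real_derivative f' x) (at x within S)) \<and> Ck_on k S f')"

definition smooth_on :: "real set \<Rightarrow> (real \<Rightarrow> real) \<Rightarrow> bool" where
  "smooth_on S f \<longleftrightarrow> (\<forall>k. Ck_on k S f)"

text \<open>
  A noncompact model manifold enters only through its dimension and the function \<open>\<psi>\<close> in its metric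
  \<open>dr \<otimes> dr + \<psi>(r)\<^sup>2 g\<close>, with \<open>g\<close> the round metric of the unit sphere.
\<close>

definition model_function :: "(real \<Rightarrow> real) \<Rightarrow> bool" where
  "model_function \<psi> \<longleftrightarrow>
     Ck_on 1 {0..} \<psi> \<and> smooth_on {0<..} \<psi> \<and> (\<forall>r>0. \<psi> r > 0) \<and>
     \<psi> 0 = 0 \<and> (\<psi> has_real_derivative 1) (at 0 within {0..})"

text \<open>
  The radial sectional curvature is \<open>-\<psi>''/\<psi>\<close> and the tangential one is \<open>(1 - \<psi>'\<^sup>2)/\<psi>\<^sup>2\<close>. As
  \<open>\<psi>'(0) = 1\<close>, both are nonpositive if and only if \<open>\<psi>\<close> is convex.
\<close>

definition cartan_hadamard_model :: "(real \<Rightarrow> real) \<Rightarrow> bool" where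
  "cartan_hadamard_model \<psi> \<longleftrightarrow> model_function \<psi> \<and> convex_on {0..} \<psi>"

text \<open>
  \<open>(u, v)\<close> solves the Cauchy problem \<open>CP(\<xi>, \<eta>)\<close> on \<open>[0, R)\<close>. The two-sided \<^const>\<open>deriv\<close> is used at
  interior points only, where \<open>C\<^sup>2\<close> regularity makes it the derivative; the initial slopes are
  one-sided. For \<open>q < 1\<close> the term \<open>\<bar>v\<bar>\<^bsup>q-1\<^esup> v\<close> is \<open>0\<close> where \<open>v = 0\<close>, by \<^term>\<open>0 powr a = (0::real)\<close>.
\<close>

definition CP_solution ::
  "nat \<Rightarrow> (real \<Rightarrow> real) \<Rightarrow> real \<Rightarrow> real \<Rightarrow> real \<Rightarrow> real \<Rightarrow> real \<Rightarrow> (real \<Rightarrow> real) \<Rightarrow> (real \<Rightarrow> real) \<Rightarrow> bool"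
where
  "CP_solution n \<psi> p q \<xi> \<eta> R u v \<longleftrightarrow>
     Ck_on 1 {0..<R} u \<and> Ck_on 2 {0<..<R} u \<and>
     Ck_on 1 {0..<R} v \<and> Ck_on 2 {0<..<R} v \<and>
     (\<forall>r\<in>{0<..<R}.
        deriv (\<lambda>s. \<psi> s ^ (n - 1) * deriv u s) r + \<psi> r ^ (n - 1) * \<bar>v r\<bar> powr (q - 1) * v r = 0 \<and>
        deriv (\<lambda>s. \<psi> s ^ (n - 1) * deriv v s) r + \<psi> r ^ (n - 1) * \<bar>u r\<bar> powr (p - 1) * u r = 0) \<and>
     (u has_real_derivative 0) (at 0 within {0..<R}) \<and>
     (v has_real_derivative 0) (at 0 within {0..<R}) \<and>
     u 0 = \<xi> \<and> v 0 = \<eta>"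

end

theory Submission
  imports Defs
begin

text \<open>
  Pohozaev's argument. Let \<open>w = \<psi>\<^bsup>n-1\<^esup>\<close> and \<open>K(r) = \<integral>\<^sub>0\<^sup>r w\<close>. Along a positive solution the quantity
  \<open>K (u' v' + v\<^bsup>q+1\<^esup>/(q+1) + u\<^bsup>p+1\<^esup>/(p+1)) + w u' v/(q+1) + w u v'/(p+1)\<close>
  vanishes at \<open>0\<close> and has derivative \<open>w u' v' (1 + 1/(p+1) + 1/(q+1) - 2 K w'/w\<^sup>2)\<close>. Both \<open>w u'\<close> and
  \<open>w v'\<close> are negative and decreasing. Since \<open>\<psi>'\<close> is nondecreasing, \<open>\<psi>\<^sup>n \<le> n \<psi>' K\<close>, that is
  \<open>2 K w'/w\<^sup>2 \<ge> 2 (n-1)/n\<close>, so in the (super)critical range the quantity is nonincreasing,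
  hence nonpositive. But near a common zero \<open>R\<close> of \<open>u\<close> and \<open>v\<close> the term \<open>K u' v'\<close> dominates and is
  positive.
\<close>

section \<open>Radial derivatives and their weighted fluxes\<close>

text \<open>The equations are written with \<open>deriv\<close>, which is total and says nothing
  about differentiability or about behaviour at \<open>0\<close>. The \<open>C^1\<close> derivative
  \<open>u1\<close> is continuous up to \<open>0\<close> and agrees with the \<open>C^2\<close>
  derivative inside, so the flux \<open>w * u1\<close> is continuous at \<open>0\<close> and the
  equations become genuine derivative facts for it.\<close>

lemma Ck_on_flux:
  fixes u w w' :: "real \<Rightarrow> real"
  assumes C1: "Ck_on 1 {0..<R} u" and C2: "Ck_on 2 {0<..<R} u"
    and w: "\<And>r. r \<in> {0<..<R} \<Longrightarrow> (w has_real_derivative w' r) (at r)"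
  obtains u1 where "continuous_on {0..<R} u1"
    and "\<And>r. r \<in> {0<..<R} \<Longrightarrow> (u has_real_derivative u1 r) (at r)"
    and "\<And>r. r \<in> {0<..<R} \<Longrightarrow>
      ((\<lambda>s. w s * u1 s) has_real_derivative deriv (\<lambda>s. w s * deriv u s) r) (at r)"
proof -
  from C1 obtain u1 where u1: "\<forall>x\<in>{0..<R}. (u has_real_derivative u1 x) (at x within {0..<R})"
    and cont: "continuous_on {0..<R} u1"
    by auto
  from C2 obtain g g' where g: "\<forall>x\<in>{0<..<R}. (u has_real_derivative g x) (at x within {0<..<R})"
    and g': "\<forall>x\<in>{0<..<R}. (g has_real_derivative g' x) (at x within {0<..<R})"
    by (auto simp: numeral_2_eq_2)
  have at: "at r within {0<..<R} = at r" if "r \<in> {0<..<R}" for r :: real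
    using that by (intro at_within_open) auto
  have du: "(u has_real_derivative u1 r) (at r)" if "r \<in> {0<..<R}" for r
    using DERIV_subset[of u "u1 r" r "{0..<R}" "{0<..<R}"] u1 that at[OF that]
    by (force simp: subset_iff)
  have eq: "g r = u1 r" "deriv u r = u1 r" if "r \<in> {0<..<R}" for r
    using du[OF that] g at[OF that] that by (metis DERIV_unique, metis DERIV_imp_deriv)
  have "((\<lambda>s. w s * u1 s) has_real_derivative deriv (\<lambda>s. w s * deriv u s) r) (at r)"
    if r: "r \<in> {0<..<R}" for r
  proof -
    have "((\<lambda>s. w s * g s) has_real_derivative w' r * g r + g' r * w r) (at r)"
      using w[OF r] bspec[OF g' r] at[OF r] by (intro DERIV_mult) auto
    \<comment> \<open>Stated for an arbitrary \<open>h\<close> because it is used twice: with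
      \<open>deriv u\<close> to evaluate the \<open>deriv\<close> in the equation, and with
      \<open>u1\<close> for the conclusion.\<close>
    then have D: "((\<lambda>s. w s * h s) has_real_derivative w' r * g r + g' r * w r) (at r)"
      if "\<And>s. s \<in> {0<..<R} \<Longrightarrow> h s = g s" for h
      by (rule has_field_derivative_transform_within_open[where S = "{0<..<R}"])
        (use r that in auto)
    have "deriv (\<lambda>s. w s * deriv u s) r = w' r * g r + g' r * w r"
      by (rule DERIV_imp_deriv, rule D) (simp add: eq)
    then show ?thesis
      using D[of u1] eq by simp
  qed
  with cont du show ?thesis
    using that by blast
qed

section \<open>Consequences of convexity\<close>

lemma convex_on_deriv_mono:
  fixes f f' :: "real \<Rightarrow> real"
  assumes convex: "convex_on {0..} f"
    and f': "\<And>r. r > 0 \<Longrightarrow> (f has_real_derivative f' r) (at r)"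
    and "0 < x" "x \<le> y"
  shows "f' x \<le> f' y"
proof (cases "x = y")
  case False
  have tangent: "f t - f s \<ge> f' s * (t - s)" if "s > 0" "t > 0" for s t
    using that
    by (intro convex_on_imp_above_tangent[OF convex])
      (auto intro: DERIV_subset[OF f'] simp: interior_real_atLeast)
  \<comment> \<open>The sum of the two tangent inequalities, at \<open>x\<close> and at
    \<open>y\<close>.\<close>
  have "f' x * (y - x) \<le> f' y * (y - x)"
    using tangent[of x y] tangent[of y x] assms by (simp add: algebra_simps)
  with False assms show ?thesis
    by simp
qed simp

text \<open>Freeze \<open>f' r\<close> and let only the upper limit \<open>s\<close> of the integral
  vary: the difference \<open>h\<close> vanishes at \<open>0\<close> and has derivative
  \<open>n * f s ^ (n - 1) * (f' r - f' s)\<close>, nonnegative by monotonicity. Freezing avoids a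
  second derivative of \<open>f\<close>. Equality holds for \<open>f r = r\<close>, the Euclidean
  case.\<close>

lemma power_le_deriv_mult_integral:
  fixes f f' :: "real \<Rightarrow> real"
  assumes cont: "continuous_on {0..} f" and "f 0 = 0" and pos: "\<And>r. r > 0 \<Longrightarrow> f r > 0"
    and f': "\<And>r. r > 0 \<Longrightarrow> (f has_real_derivative f' r) (at r)"
    and mono: "\<And>x y. 0 < x \<Longrightarrow> x \<le> y \<Longrightarrow> f' x \<le> f' y"
    and "n > 0" "r > 0"
  shows "f r ^ n \<le> real n * f' r * integral {0..r} (\<lambda>s. f s ^ (n - 1))"
proof -
  define K where "K = (\<lambda>r. integral {0..r} (\<lambda>s. f s ^ (n - 1)))"
  define h where "h = (\<lambda>s. real n * f' r * K s - f s ^ n)"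
  have contw: "continuous_on {0..r} (\<lambda>s. f s ^ (n - 1))"
    by (intro continuous_intros continuous_on_subset[OF cont]) auto
  have K': "(K has_real_derivative f s ^ (n - 1)) (at s within {0..r})" if "s \<in> {0..r}" for s
    unfolding K_def by (rule integral_has_real_derivative[OF contw that])
  have "h 0 \<le> h r"
  proof (rule DERIV_nonneg_imp_increasing_open[where f = h])
    show "continuous_on {0..r} h"
      unfolding h_def using K'
      by (intro continuous_intros continuous_on_subset[OF cont] DERIV_continuous_on) auto
    fix s assume s: "0 < s" "s < r"
    then have "(K has_real_derivative f s ^ (n - 1)) (at s)"
      using K'[of s] by (simp add: at_within_Icc_at)
    then have "(h has_real_derivative real n * f s ^ (n - 1) * (f' r - f' s)) (at s)"
      unfolding h_def using s
      by (auto intro!: derivative_eq_intros f' simp: algebra_simps)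
    moreover have "real n * f s ^ (n - 1) * (f' r - f' s) \<ge> 0"
      using mono[of s r] pos[of s] s by simp
    ultimately show "\<exists>y. (h has_real_derivative y) (at s) \<and> y \<ge> 0"
      by blast
  qed (use \<open>r > 0\<close> in simp)
  then show ?thesis
    using \<open>f 0 = 0\<close> \<open>n > 0\<close> by (simp add: h_def K_def zero_power)
qed

section \<open>The Pohozaev argument for an abstract weight\<close>

lemma flux_negative_decreasing:
  fixes w u1 f :: "real \<Rightarrow> real"
  assumes "continuous_on {0..<R} w" "continuous_on {0..<R} u1" "w 0 = 0"
    and pos: "\<And>r. r \<in> {0<..<R} \<Longrightarrow> w r > 0" "\<And>r. r \<in> {0<..<R} \<Longrightarrow> f r > 0"
    and flux: "\<And>r. r \<in> {0<..<R} \<Longrightarrow> ((\<lambda>s. w s * u1 s) has_real_derivative - w r * f r) (at r)"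
    and st: "0 \<le> s" "s < t" "t < R"
  shows "w t * u1 t < w s * u1 s" and "w t * u1 t < 0"
proof -
  have less: "w t * u1 t < w s * u1 s" if st: "0 \<le> s" "s < t" "t < R" for s
  proof (rule DERIV_neg_imp_decreasing_open[OF \<open>s < t\<close>, where f = "\<lambda>s. w s * u1 s"])
    show "continuous_on {s..t} (\<lambda>s. w s * u1 s)"
      using st by (intro continuous_intros; intro continuous_on_subset[OF assms(1)]
          continuous_on_subset[OF assms(2)]) auto
    fix x assume "s < x" "x < t"
    with st have "x \<in> {0<..<R}"
      by auto
    then show "\<exists>y. ((\<lambda>s. w s * u1 s) has_real_derivative y) (at x) \<and> y < 0"
      using flux pos by (intro exI[of _ "- w x * f x"]) auto
  qed
  \<comment> \<open>The sign is the case \<open>s = 0\<close> of the monotonicity, since the flux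
    vanishes there together with \<open>w\<close>.\<close>
  show "w t * u1 t < w s * u1 s" "w t * u1 t < 0"
    using less[OF st] less[of 0] st \<open>w 0 = 0\<close> by auto
qed

text \<open>The geometry and the exponent condition are condensed into \<open>critical\<close>,
  which is exactly what makes the Pohozaev quantity \<open>P\<close> nonincreasing.\<close>

lemma radial_pohozaev_nonexistence:
  fixes w w' K u u1 v v1 :: "real \<Rightarrow> real" and p q R :: real
  assumes "R > 0" "p > 0" "q > 0"
    and cont: "continuous_on {0..R} w" "continuous_on {0..R} K"
      "continuous_on {0..R} u" "continuous_on {0..R} v"
      "continuous_on {0..<R} u1" "continuous_on {0..<R} v1"
    and "w 0 = 0" "K 0 = 0" "u R = 0" "v R = 0"
    and w_pos: "\<And>r. 0 < r \<Longrightarrow> r \<le> R \<Longrightarrow> w r > 0"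
    and uv_pos: "\<And>r. r \<in> {0..<R} \<Longrightarrow> u r > 0" "\<And>r. r \<in> {0..<R} \<Longrightarrow> v r > 0"
    and w': "\<And>r. r \<in> {0<..<R} \<Longrightarrow> (w has_real_derivative w' r) (at r)"
    and K': "\<And>r. r \<in> {0<..<R} \<Longrightarrow> (K has_real_derivative w r) (at r)"
    and u': "\<And>r. r \<in> {0<..<R} \<Longrightarrow> (u has_real_derivative u1 r) (at r)"
    and v': "\<And>r. r \<in> {0<..<R} \<Longrightarrow> (v has_real_derivative v1 r) (at r)"
    and wu': "\<And>r. r \<in> {0<..<R} \<Longrightarrow>
      ((\<lambda>s. w s * u1 s) has_real_derivative - w r * v r powr q) (at r)"
    and wv': "\<And>r. r \<in> {0<..<R} \<Longrightarrow>
      ((\<lambda>s. w s * v1 s) has_real_derivative - w r * u r powr p) (at r)"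
    and critical: "\<And>r. r \<in> {0<..<R} \<Longrightarrow>
      (1 + 1 / (p + 1) + 1 / (q + 1)) * (w r)\<^sup>2 \<le> 2 * K r * w' r"
  shows False
proof -
  define a where "a = 1 / (q + 1)"
  define b where "b = 1 / (p + 1)"
  have ab: "a > 0" "b > 0" "(q + 1) * a = 1" "(p + 1) * b = 1"
    using \<open>p > 0\<close> \<open>q > 0\<close> by (auto simp: a_def b_def)
  have contR: "continuous_on {0..<R} w" "continuous_on {0..<R} K"
    "continuous_on {0..<R} u" "continuous_on {0..<R} v"
    by (rule cont(1-4)[THEN continuous_on_subset], force)+
  have w_pos': "w r > 0" and powr_pos: "v r powr q > 0" "u r powr p > 0" if "r \<in> {0<..<R}" for r
    using that w_pos[of r] uv_pos[of r] by auto
  have flux_u: "w t * u1 t < w s * u1 s" "w t * u1 t < 0"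
    and flux_v: "w t * v1 t < w s * v1 s" "w t * v1 t < 0" if "0 \<le> s" "s < t" "t < R" for s t
    using flux_negative_decreasing[where f = "\<lambda>r. v r powr q",
        OF contR(1) cont(5) \<open>w 0 = 0\<close> w_pos' powr_pos(1) wu' that]
      flux_negative_decreasing[where f = "\<lambda>r. u r powr p",
        OF contR(1) cont(6) \<open>w 0 = 0\<close> w_pos' powr_pos(2) wv' that] by blast+
  have neg: "u1 t < 0" "v1 t < 0" if "0 < t" "t < R" for t
    using flux_u(2)[OF order.refl that] flux_v(2)[OF order.refl that] w_pos[of t] that
    by (auto simp: mult_less_0_iff)
  \<comment> \<open>\<open>P\<close> contains \<open>u1 * v1\<close>, whose factors are known to be
    differentiable only through their fluxes; dividing by \<open>w\<close> recovers their
    derivatives.\<close>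
  have quotient: "(f has_real_derivative (d - w' r * f r) / w r) (at r)"
    if "((\<lambda>s. w s * f s) has_real_derivative d) (at r)" "r \<in> {0<..<R}" for f d r
  proof -
    have "w r > 0" using w_pos' that by blast
    then have "(d * w r - w r * f r * w' r) / (w r * w r) = (d - w' r * f r) / w r"
      by (simp add: field_simps)
    with DERIV_divide[OF that(1) w'[OF that(2)]] \<open>w r > 0\<close>
    have "((\<lambda>s. (w s * f s) / w s) has_real_derivative (d - w' r * f r) / w r) (at r)"
      by (metis less_irrefl)
    then show ?thesis
      by (rule has_field_derivative_transform_within_open[where S = "{0<..<R}"])
        (use that w_pos' in force)+
  qed
  define P where "P = (\<lambda>r. K r * (u1 r * v1 r + a * v r powr (q + 1) + b * u r powr (p + 1))
     + a * (w r * u1 r) * v r + b * (w r * v1 r) * u r)"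
  have P_nonpos: "P t \<le> 0" if t: "0 < t" "t < R" for t
  proof -
    have "P t \<le> P 0"
    proof (rule DERIV_nonpos_imp_decreasing_open[where f = P])
      have pos: "u s \<noteq> 0" "v s \<noteq> 0" if "s \<in> {0..t}" for s
        using uv_pos[of s] that t by auto
      have sub: "{0..t} \<subseteq> {0..<R}"
        using t by auto
      show "continuous_on {0..t} P"
        unfolding P_def using pos
        by (intro continuous_intros contR[THEN continuous_on_subset, OF sub]
            cont(5,6)[THEN continuous_on_subset, OF sub]) auto
      fix r assume "0 < r" "r < t"
      with t have r: "r \<in> {0<..<R}" by auto
      then have pos: "w r > 0" "u r > 0" "v r > 0"
        using w_pos[of r] uv_pos[of r] by auto
      have powr: "v r powr (q + 1) = v r powr q * v r" "u r powr (p + 1) = u r powr p * u r"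
        using pos by (auto simp: powr_add)
      have dv: "((\<lambda>s. a * v s powr (q + 1)) has_real_derivative v r powr q * v1 r) (at r)"
        using pos ab by (auto intro!: derivative_eq_intros v'[OF r])
      have du: "((\<lambda>s. b * u s powr (p + 1)) has_real_derivative u r powr p * u1 r) (at r)"
        using pos ab by (auto intro!: derivative_eq_intros u'[OF r])
      have "(P has_real_derivative
          w r * (u1 r * v1 r + a * v r powr (q + 1) + b * u r powr (p + 1))
          + K r * ((- w r * v r powr q - w' r * u1 r) / w r * v1 r
              + u1 r * ((- w r * u r powr p - w' r * v1 r) / w r)
              + v r powr q * v1 r + u r powr p * u1 r)
          + a * (- w r * v r powr q) * v r + a * (w r * u1 r) * v1 r
          + b * (- w r * u r powr p) * u r + b * (w r * v1 r) * u1 r) (at r)"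
        unfolding P_def
        by (rule derivative_eq_intros refl K'[OF r] u'[OF r] v'[OF r] wu'[OF r] wv'[OF r] du dv
            quotient[OF wu'[OF r] r] quotient[OF wv'[OF r] r])+ (simp add: algebra_simps)
      \<comment> \<open>The factors \<open>a\<close> and \<open>b\<close> are chosen so that all
        terms with powers of \<open>u\<close> and \<open>v\<close> cancel, leaving a multiple of
        \<open>u1 r * v1 r\<close>, which is positive.\<close>
      also have "w r * (u1 r * v1 r + a * v r powr (q + 1) + b * u r powr (p + 1))
          + K r * ((- w r * v r powr q - w' r * u1 r) / w r * v1 r
              + u1 r * ((- w r * u r powr p - w' r * v1 r) / w r)
              + v r powr q * v1 r + u r powr p * u1 r)
          + a * (- w r * v r powr q) * v r + a * (w r * u1 r) * v1 r
          + b * (- w r * u r powr p) * u r + b * (w r * v1 r) * u1 r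
        = u1 r * v1 r / w r * ((1 + b + a) * (w r)\<^sup>2 - 2 * K r * w' r)"
        using pos unfolding powr by (simp add: field_simps power2_eq_square)
      finally have "(P has_real_derivative
        u1 r * v1 r / w r * ((1 + b + a) * (w r)\<^sup>2 - 2 * K r * w' r)) (at r)" .
      moreover have "u1 r * v1 r / w r * ((1 + b + a) * (w r)\<^sup>2 - 2 * K r * w' r) \<le> 0"
        using critical[OF r] neg[of r] pos r
        by (intro mult_nonneg_nonpos) (auto simp: a_def b_def mult_nonpos_nonpos)
      ultimately show "\<exists>y. (P has_real_derivative y) (at r) \<and> y \<le> 0"
        by blast
    qed (use t in simp)
    then show ?thesis
      using \<open>w 0 = 0\<close> \<open>K 0 = 0\<close> by (simp add: P_def)
  qed

  \<comment> \<open>Any interior point would do. Beyond \<open>m\<close>, both fluxes exceed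
    \<open>c\<close> in absolute value and \<open>K / w\<^sup>2\<close> is at least
    \<open>k\<close>.\<close>
  define m where "m = R / 2"
  have m: "0 < m" "m < R" using \<open>R > 0\<close> by (auto simp: m_def)
  have K_mono: "K s < K t" if "0 \<le> s" "s < t" "t < R" for s t
  proof (rule DERIV_pos_imp_increasing_open[OF \<open>s < t\<close>, where f = K])
    show "continuous_on {s..t} K"
      using that by (intro continuous_on_subset[OF cont(2)]) auto
    fix x assume "s < x" "x < t"
    then show "\<exists>y. (K has_real_derivative y) (at x) \<and> y > 0"
      using K'[of x] w_pos[of x] that by auto
  qed
  have "K m > 0"
    using K_mono[of 0 m] m \<open>K 0 = 0\<close> by simp
  obtain W where W: "\<And>r. r \<in> {0..R} \<Longrightarrow> w r \<le> W"
    using continuous_attains_sup[OF compact_Icc _ cont(1)] \<open>R > 0\<close> by force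
  have "W > 0"
    using W[of R] w_pos[of R] \<open>R > 0\<close> by simp
  define c where "c = min (- (w m * u1 m)) (- (w m * v1 m))"
  have "c > 0"
    using flux_u(2)[OF order.refl m] flux_v(2)[OF order.refl m] by (simp add: c_def)
  define k where "k = K m / W\<^sup>2"
  have "k > 0"
    using \<open>K m > 0\<close> \<open>W > 0\<close> by (simp add: k_def)
  \<comment> \<open>Chosen so that \<open>(X + Y) * e \<le> k * X * Y\<close> whenever
    \<open>X\<close> and \<open>Y\<close> are at least \<open>c\<close>; no upper bound on the
    fluxes enters.\<close>
  define e where "e = c * k / 2"
  have "e > 0"
    using \<open>c > 0\<close> \<open>k > 0\<close> by (simp add: e_def)
  have lim: "((\<lambda>r. a * v r) \<longlongrightarrow> 0) (at_left R)" "((\<lambda>r. b * u r) \<longlongrightarrow> 0) (at_left R)"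
    using continuous_on_Icc_at_leftD[OF cont(3)] continuous_on_Icc_at_leftD[OF cont(4)]
      \<open>R > 0\<close> \<open>u R = 0\<close> \<open>v R = 0\<close> by (auto intro!: tendsto_mult_right_zero)
  \<comment> \<open>\<open>u1\<close> and \<open>v1\<close> are controlled only before
    \<open>R\<close>, so the contradiction is reached at a point \<open>r\<close> slightly to its
    left.\<close>
  have "eventually (\<lambda>r. a * v r < e \<and> b * u r < e \<and> r \<in> {m<..<R}) (at_left R)"
    using order_tendstoD(2)[OF lim(1) \<open>e > 0\<close>] order_tendstoD(2)[OF lim(2) \<open>e > 0\<close>]
      eventually_at_left_real[OF m(2)]
    by eventually_elim auto
  then obtain r where r: "a * v r < e" "b * u r < e" "m < r" "r < R"
    using eventually_happens'[OF trivial_limit_at_left_real] by fastforce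
  define X where "X = - (w r * u1 r)"
  define Y where "Y = - (w r * v1 r)"
  have XY: "X > c" "Y > c"
    using flux_u(1)[of m r] flux_v(1)[of m r] r m by (auto simp: X_def Y_def c_def)
  have pos: "w r > 0" "u r > 0" "v r > 0" "K r > 0"
    using w_pos[of r] uv_pos[of r] K_mono[of 0 r] r m \<open>K 0 = 0\<close> by auto
  have "k \<le> K r / (w r)\<^sup>2"
    unfolding k_def using K_mono[of m r] W[of r] r m pos
    by (intro frac_le power_mono) auto
  then have "k * (X * Y) \<le> K r / (w r)\<^sup>2 * (X * Y)"
    using XY \<open>c > 0\<close> by (intro mult_right_mono) auto
  also have "\<dots> = K r * (u1 r * v1 r)"
    using pos by (simp add: X_def Y_def power2_eq_square)
  also have "\<dots> \<le> K r * (u1 r * v1 r + a * v r powr (q + 1) + b * u r powr (p + 1))"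
    using pos ab by (intro mult_left_mono) auto
  \<comment> \<open>With \<open>P r \<le> 0\<close>, the product of the fluxes is bounded by a
    combination linear in them with small coefficients.\<close>
  also have "\<dots> = P r + X * (a * v r) + Y * (b * u r)"
    by (simp add: P_def X_def Y_def)
  also have "\<dots> \<le> X * (a * v r) + Y * (b * u r)"
    using P_nonpos[of r] r m by simp
  also have "\<dots> < X * e + Y * e"
    using XY \<open>c > 0\<close> r by (intro add_strict_mono mult_strict_left_mono) auto
  also have "\<dots> = k * (c * X + Y * c) / 2"
    by (simp add: e_def algebra_simps)
  also have "\<dots> \<le> k * (Y * X + Y * X) / 2"
    using XY \<open>c > 0\<close> \<open>k > 0\<close>
    by (intro divide_right_mono mult_left_mono add_mono mult_right_mono) auto
  finally show False
    by (simp add: algebra_simps)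
qed

section \<open>Application to Cartan-Hadamard models\<close>

theorem proposition1p4:
  fixes n :: nat and \<psi> :: "real \<Rightarrow> real" and p q \<xi> \<eta> :: real
  assumes "n \<ge> 3"
    and "cartan_hadamard_model \<psi>"
    and "p > 0" and "q > 0"
    and "1 / (p + 1) + 1 / (q + 1) \<le> (real n - 2) / real n"
    and "\<xi> > 0" and "\<eta> > 0"
  shows "\<not> (\<exists>R>0. \<exists>u v. CP_solution n \<psi> p q \<xi> \<eta> R u v \<and>
             continuous_on {0..R} u \<and> continuous_on {0..R} v \<and> u R = 0 \<and> v R = 0 \<and>
             (\<forall>r\<in>{0<..<R}. u r > 0 \<and> v r > 0))"
proof (rule notI, elim exE conjE)
  fix R u v
  assume "R > 0" and sol: "CP_solution n \<psi> p q \<xi> \<eta> R u v"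
    and cont: "continuous_on {0..R} u" "continuous_on {0..R} v" and zero: "u R = 0" "v R = 0"
    and pos: "\<forall>r\<in>{0<..<R}. u r > 0 \<and> v r > 0"
  have convex: "convex_on {0..} \<psi>" and \<psi>_pos: "\<And>r. r > 0 \<Longrightarrow> \<psi> r > 0" and \<psi>0: "\<psi> 0 = 0"
    and "Ck_on 1 {0..} \<psi>"
    using assms(2) by (auto simp: cartan_hadamard_model_def model_function_def)
  then obtain \<psi>' where D: "\<forall>r\<in>{0..}. (\<psi> has_real_derivative \<psi>' r) (at r within {0..})"
    by auto
  have cont\<psi>: "continuous_on {0..} \<psi>"
    by (rule DERIV_continuous_on[OF bspec[OF D]])
  have \<psi>': "(\<psi> has_real_derivative \<psi>' r) (at r)" if "r > 0" for r
  proof -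
    have "(\<psi> has_real_derivative \<psi>' r) (at r within {0<..})"
      by (rule DERIV_subset[OF bspec[OF D]]) (use that in auto)
    moreover have "at r within {0<..} = at r"
      using that by (intro at_within_open) auto
    ultimately show ?thesis
      by simp
  qed
  \<comment> \<open>Up to the area of the unit sphere, \<open>w\<close> is the area of the geodesic
    sphere of radius \<open>r\<close> and \<open>K\<close> the volume of the ball it bounds.\<close>
  define w where "w = (\<lambda>r. \<psi> r ^ (n - 1))"
  define w' where "w' = (\<lambda>r. real (n - 1) * \<psi> r ^ (n - 2) * \<psi>' r)"
  define K where "K = (\<lambda>r. integral {0..r} w)"
  have w': "(w has_real_derivative w' r) (at r)" if "r > 0" for r
    unfolding w_def w'_def
    by (rule derivative_eq_intros \<psi>' that refl)+ (simp add: numeral_2_eq_2)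
  have contw: "continuous_on {0..R} w"
    unfolding w_def by (intro continuous_intros continuous_on_subset[OF cont\<psi>]) auto
  have KR: "(K has_real_derivative w r) (at r within {0..R})" if "r \<in> {0..R}" for r
    unfolding K_def by (rule integral_has_real_derivative[OF contw that])
  note S = sol[unfolded CP_solution_def]
  obtain u1 where u1: "continuous_on {0..<R} u1"
    "\<And>r. r \<in> {0<..<R} \<Longrightarrow> (u has_real_derivative u1 r) (at r)"
    "\<And>r. r \<in> {0<..<R} \<Longrightarrow>
      ((\<lambda>s. w s * u1 s) has_real_derivative deriv (\<lambda>s. w s * deriv u s) r) (at r)"
    by (rule Ck_on_flux[of R u w w']) (use S w' in auto)
  obtain v1 where v1: "continuous_on {0..<R} v1"
    "\<And>r. r \<in> {0<..<R} \<Longrightarrow> (v has_real_derivative v1 r) (at r)"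
    "\<And>r. r \<in> {0<..<R} \<Longrightarrow>
      ((\<lambda>s. w s * v1 s) has_real_derivative deriv (\<lambda>s. w s * deriv v s) r) (at r)"
    by (rule Ck_on_flux[of R v w w']) (use S w' in auto)
  have absorb: "\<bar>x\<bar> powr (t - 1) * x = x powr t" if "x > 0" for x t :: real
    using that powr_add[of x "t - 1" 1] by simp
  have ode: "deriv (\<lambda>s. \<psi> s ^ (n - 1) * deriv u s) r =
      - (\<psi> r ^ (n - 1) * (\<bar>v r\<bar> powr (q - 1) * v r))"
    "deriv (\<lambda>s. \<psi> s ^ (n - 1) * deriv v s) r =
      - (\<psi> r ^ (n - 1) * (\<bar>u r\<bar> powr (p - 1) * u r))"
    if "r \<in> {0<..<R}" for r
    using S that by (simp_all only: eq_neg_iff_add_eq_0 mult.assoc)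
  have eqs: "deriv (\<lambda>s. w s * deriv u s) r = - w r * v r powr q"
    "deriv (\<lambda>s. w s * deriv v s) r = - w r * u r powr p" if "r \<in> {0<..<R}" for r
    using ode[OF that] pos that by (simp_all add: w_def mult.assoc absorb)
  \<comment> \<open>At \<open>r = 0\<close> positivity comes from the initial values
    \<open>\<xi>\<close> and \<open>\<eta>\<close>.\<close>
  have pos0: "u r > 0" "v r > 0" if "r \<in> {0..<R}" for r
    using that pos S assms by (cases "r = 0"; auto)+
  show False
  proof (rule radial_pohozaev_nonexistence[OF \<open>R > 0\<close> \<open>p > 0\<close> \<open>q > 0\<close> contw _ cont u1(1) v1(1)])
    show "continuous_on {0..R} K"
      using KR by (rule DERIV_continuous_on)
    show "w 0 = 0" "K 0 = 0"
      using assms(1) \<psi>0 by (auto simp: w_def K_def)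
    show "w r > 0" if "0 < r" for r
      using \<psi>_pos that by (simp add: w_def)
    show "(K has_real_derivative w r) (at r)" if "r \<in> {0<..<R}" for r
      using KR[of r] that by (simp add: at_within_Icc_at)
    show "(1 + 1 / (p + 1) + 1 / (q + 1)) * (w r)\<^sup>2 \<le> 2 * K r * w' r" if r: "r \<in> {0<..<R}" for r
    proof -
      have key: "\<psi> r ^ n \<le> real n * \<psi>' r * K r"
        unfolding K_def w_def using r assms(1)
        by (intro power_le_deriv_mult_integral cont\<psi> \<psi>0 \<psi>_pos \<psi>'
            convex_on_deriv_mono[OF convex \<psi>']) auto
      \<comment> \<open>Splits off the power of \<open>\<psi>\<close> that occurs in
        \<open>w'\<close>, leaving the one bounded by \<open>key\<close>.\<close>
      have "(w r)\<^sup>2 = \<psi> r ^ (n - 2) * \<psi> r ^ n"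
      proof -
        have "(n - 1) * 2 = n - 2 + n"
          using assms(1) by simp
        then show ?thesis
          by (simp only: w_def flip: power_mult power_add)
      qed
      \<comment> \<open>The exponent condition enters here, as
        \<open>1 + (n - 2) / n = 2 * (n - 1) / n\<close>.\<close>
      have "(1 + 1 / (p + 1) + 1 / (q + 1)) * (w r)\<^sup>2 \<le> 2 * real (n - 1) / real n * (w r)\<^sup>2"
        using assms(1,5) by (intro mult_right_mono) (auto simp: field_simps)
      also have "\<dots> = 2 * real (n - 1) / real n * \<psi> r ^ (n - 2) * \<psi> r ^ n"
        by (simp add: \<open>(w r)\<^sup>2 = _\<close>)
      also have "\<dots> \<le> 2 * real (n - 1) / real n * \<psi> r ^ (n - 2) * (real n * \<psi>' r * K r)"
        using \<psi>_pos[of r] r by (intro mult_left_mono key) auto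
      also have "\<dots> = 2 * K r * w' r"
        using assms(1) by (simp add: w'_def)
      finally show ?thesis .
    qed
  qed (use zero pos0 w' u1 v1 eqs in auto)
qed

end
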